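(* Let $\mathcal H$ be a real or complex Hilbert space, let $m\ge1$ be an integer, and let $(U_i)_{1\le i\le m}$ be closed vector subspaces of $\mathcal H$ satisfying the inverse best approximation property. Set $$\alpha=\sqrt{1-\prod_{i=1}^{m-1}\Big(1-\mathsf c\big(U_i^\bot,U_{i+}^\bot\big)^2\Big)}.$$ Then $\alpha\in[0,1[$ and, for every $r\in\mathcal H$ and every $(u_1,\ldots,u_m)\in U_1\times\cdots\times U_m$, the sequence $(x_n)_{n\in\mathbb N}$ defined by $$x_0=r\quad\text{and}\quad(\forall n\in\mathbb N)\quad x_{n+1}=Q_1\cdots Q_mx_n$$ satisfies $$(\forall n\in\mathbb N)\quad\|x_n-B(r;u_1,\ldots,u_m)\|\le\alpha^n\|r-B(r;u_1,\ldots,u_m)\|.$$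
   Context: Let $P_i$ be the orthogonal projector onto $U_i$. The family $(U_i)_{1\le i\le m}$ satisfies the inverse best approximation property (IBAP) if for every $(u_1,\ldots,u_m)\in U_1\times\cdots\times U_m$ there exists $x\in\mathcal H$ such that $P_ix=u_i$ for every $i\in\{1,\ldots,m\}$. $U_{i+}=\sum_{j=i+1}^mU_j$. For closed vector subspaces $U,V$ of $\mathcal H$, $\mathsf c(U,V)=\sup\{|\langle x\mid y\rangle| : x\in U\cap(U\cap V)^\bot,\ y\in V\cap(U\cap V)^\bot,\ \|x\|\le1,\ \|y\|\le1\}$. For given $(u_1,\ldots,u_m)$, $Q_i$ is the projector onto the closed affine subspace $u_i+U_i^\bot$, i.e. $Q_ix=u_i+x-P_ix$, and $B(r;u_1,\ldots,u_m)$ is the best approximation to (projection of) $r$ from the set $S(u_1,\ldots,u_m)=\{x\in\mathcal H : P_ix=u_i\ \text{for all } i\}=\bigcap_{i=1}^m(u_i+U_i^\bot)$ (nonempty under the IBAP). Convention: $0^0=1$ and an empty product equals $1$. *)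

theory Defs
  imports "HOL-Analysis.Analysis"
begin

section \<open>Real or complex scalars\<close>

text \<open>
  HOL-Analysis has real inner product spaces only. The class below treats the scalar fields of
  real and of complex numbers uniformly: both are instances, and
  \<open>real_or_complex_cases\<close> shows that there are no others up to isomorphism.
  Multiplicativity and involutivity of the conjugation follow from the two axioms.
\<close>

class real_or_complex = real_normed_field +
  fixes conjugate :: "'a \<Rightarrow> 'a"
  assumes conjugate_add: "conjugate (a + b) = conjugate a + conjugate b"
    and mult_conjugate_scaleR: "a * conjugate a = (norm a)\<^sup>2 *\<^sub>R 1"

instantiation real :: real_or_complex
begin
definition conjugate_real :: "real \<Rightarrow> real" where "conjugate_real a = a"
instance by standard (simp_all add: conjugate_real_def power2_eq_square)
end

instantiation complex :: real_or_complex
begin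
definition conjugate_complex :: "complex \<Rightarrow> complex" where "conjugate_complex = cnj"
instance by standard
  (simp_all add: conjugate_complex_def scaleR_conv_of_real flip: complex_norm_square)
end

lemma mult_conjugate: "z * conjugate z = (of_real ((norm z)\<^sup>2) :: 'k::real_or_complex)"
  by (simp add: mult_conjugate_scaleR of_real_def)

lemma conjugate_of_real [simp]: "conjugate (of_real t :: 'k::real_or_complex) = of_real t"
proof (cases "t = 0")
  case True
  have "conjugate (0::'k) + conjugate 0 = conjugate 0"
    by (metis add_0 conjugate_add)
  then show ?thesis using True by simp
next
  case False
  have "of_real t * conjugate (of_real t :: 'k) = of_real t * of_real t"
    by (simp add: mult_conjugate power2_eq_square flip: of_real_mult)
  then show ?thesis using False by simp
qed

lemma add_conjugate_real: "\<exists>t. z + conjugate z = (of_real t :: 'k::real_or_complex)"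
proof -
  have one: "conjugate (1::'k) = 1" using conjugate_of_real[of 1] by simp
  have "(1 + z) * (1 + conjugate z) = of_real ((norm (1 + z))\<^sup>2)"
    using mult_conjugate[of "1 + z"] by (simp add: conjugate_add one)
  then have "z + conjugate z = of_real ((norm (1 + z))\<^sup>2) - 1 - z * conjugate z"
    by (simp add: algebra_simps)
  also have "\<dots> = of_real ((norm (1 + z))\<^sup>2 - 1 - (norm z)\<^sup>2)"
    by (simp add: mult_conjugate)
  finally show ?thesis by blast
qed

lemma real_or_complex_square:
  fixes z :: "'k::real_or_complex"
  shows "\<exists>a b. (z - of_real a)\<^sup>2 = of_real b"
proof -
  obtain t where t: "z + conjugate z = of_real t" using add_conjugate_real by blast
  have "z * (of_real t - z) = of_real ((norm z)\<^sup>2)"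
    using mult_conjugate[of z] t by (metis add_diff_cancel_left')
  then have "z\<^sup>2 = of_real t * z - of_real ((norm z)\<^sup>2)"
    by (simp add: algebra_simps power2_eq_square)
  moreover define h where "h = (of_real (t/2) :: 'k)"
  have "of_real t = h + h" by (simp add: h_def flip: of_real_add)
  ultimately have "(z - h)\<^sup>2 = h * h - of_real ((norm z)\<^sup>2)"
    by (simp add: power2_eq_square algebra_simps)
  also have "\<dots> = of_real (t/2 * (t/2) - (norm z)\<^sup>2)"
    by (simp only: h_def of_real_mult of_real_diff)
  finally show ?thesis unfolding h_def by blast
qed

lemma real_or_complex_cases:
  "(\<forall>z::'k::real_or_complex. \<exists>a. z = of_real a) \<or>
   (\<exists>i::'k. i * i = -1 \<and> (\<forall>z. \<exists>a b. z = of_real a + of_real b * i))"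
proof (cases "\<exists>i::'k. i * i = -1")
  case True
  then obtain i :: 'k where i: "i * i = -1" by blast
  have "\<exists>a b. z = of_real a + of_real b * i" for z
  proof -
    obtain a b where ab: "(z - of_real a)\<^sup>2 = of_real b" using real_or_complex_square by blast
    show ?thesis
    proof (cases "b \<ge> 0")
      case True
      then have "(z - of_real a)\<^sup>2 = (of_real (sqrt b))\<^sup>2"
        using ab by (simp flip: of_real_power)
      then have "z - of_real a = of_real (sqrt b) \<or> z - of_real a = - of_real (sqrt b)"
        by (simp add: power2_eq_iff)
      then have "z = of_real (a + sqrt b) + of_real 0 * i \<or> z = of_real (a - sqrt b) + of_real 0 * i"
        by (auto simp: algebra_simps)
      then show ?thesis by blast
    next
      case False
      then have "(of_real (sqrt (-b)))\<^sup>2 = (of_real (-b) :: 'k)"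
        by (metis less_eq_real_def linorder_not_le neg_0_le_iff_le of_real_power real_sqrt_pow2)
      then have "(z - of_real a)\<^sup>2 = (of_real (sqrt (-b)) * i)\<^sup>2"
        using ab i by (simp add: power_mult_distrib power2_eq_square[of i])
      then have "z - of_real a = of_real (sqrt (-b)) * i \<or> z - of_real a = - (of_real (sqrt (-b)) * i)"
        by (simp only: power2_eq_iff)
      then have "z = of_real a + of_real (sqrt (-b)) * i \<or> z = of_real a + of_real (- sqrt (-b)) * i"
        by (auto simp: algebra_simps)
      then show ?thesis by blast
    qed
  qed
  with i show ?thesis by blast
next
  case False
  have "\<exists>a. z = of_real a" for z :: 'k
  proof -
    obtain a b where ab: "(z - of_real a)\<^sup>2 = of_real b" using real_or_complex_square by blast
    have "b \<ge> 0"
    proof (rule ccontr)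
      assume "\<not> b \<ge> 0"
      define s where "s = (of_real (sqrt (-b)) :: 'k)"
      have s2: "s\<^sup>2 = of_real (-b)" unfolding s_def using \<open>\<not> b \<ge> 0\<close>
        by (metis less_eq_real_def linorder_not_le neg_0_le_iff_le of_real_power real_sqrt_pow2)
      have "((z - of_real a) / s)\<^sup>2 = -1"
        using ab s2 \<open>\<not> b \<ge> 0\<close> by (simp add: power_divide)
      with False show False by (metis power2_eq_square)
    qed
    then have "(z - of_real a)\<^sup>2 = (of_real (sqrt b))\<^sup>2"
      using ab by (simp flip: of_real_power)
    then have "z - of_real a = of_real (sqrt b) \<or> z - of_real a = - of_real (sqrt b)"
      by (simp add: power2_eq_iff)
    then have "z = of_real (a + sqrt b) \<or> z = of_real (a - sqrt b)"
      by (auto simp: algebra_simps)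
    then show ?thesis by blast
  qed
  then show ?thesis by blast
qed


section \<open>Hilbert spaces\<close>

text \<open>
  Completeness and the topology come from the class \<open>banach\<close> of the vectors; the last two
  axioms make its norm the one induced by the inner product, and its underlying real vector space
  the restriction of scalars. The inner product is linear in its first argument.
\<close>

locale hilbert_space = vector_space scale
  for scale :: "'k::real_or_complex \<Rightarrow> 'a::banach \<Rightarrow> 'a" +
  fixes ip :: "'a \<Rightarrow> 'a \<Rightarrow> 'k"
  assumes ip_add_left: "ip (x + y) z = ip x z + ip y z"
    and ip_scale_left: "ip (scale c x) y = c * ip x y"
    and ip_conjugate: "ip y x = conjugate (ip x y)"
    and ip_self: "ip x x = of_real ((norm x)\<^sup>2)"
    and scale_of_real: "scale (of_real t) x = t *\<^sub>R x"

lemma hilbert_space_real: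
  "hilbert_space (scaleR :: real \<Rightarrow> 'a \<Rightarrow> 'a) (inner :: 'a::{real_inner,banach} \<Rightarrow> 'a \<Rightarrow> real)"
proof
  show "inner y x = conjugate (inner x y)" for x y :: 'a
    by (simp add: conjugate_real_def inner_commute)
  show "inner x x = of_real ((norm x)\<^sup>2)" for x :: 'a
    by (simp add: power2_norm_eq_inner)
qed (simp_all add: scaleR_add_right scaleR_add_left inner_add_left)

lemma hilbert_space_complex:
  "hilbert_space ((*) :: complex \<Rightarrow> complex \<Rightarrow> complex) (\<lambda>x y. x * cnj y)"
proof
  show "x * cnj x = of_real ((norm x)\<^sup>2)" for x
    by (simp only: complex_norm_square)
qed (simp_all add: ring_distribs conjugate_complex_def scaleR_conv_of_real)

definition orth :: "('a \<Rightarrow> 'a \<Rightarrow> 'k::zero) \<Rightarrow> 'a set \<Rightarrow> 'a set"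
  where "orth ip U = {x. \<forall>y\<in>U. ip x y = 0}"

text \<open>
  \<open>proj S x\<close> is the best approximation to \<open>x\<close> from \<open>S\<close>, which exists and is unique when
  \<open>S\<close> is a nonempty closed convex subset of a Hilbert space. (The constant
  \<open>closest_point\<close> of HOL-Analysis requires locally compact spaces.)
\<close>

definition proj :: "'a::metric_space set \<Rightarrow> 'a \<Rightarrow> 'a"
  where "proj S x = (THE p. p \<in> S \<and> (\<forall>y\<in>S. dist x p \<le> dist x y))"

lemma (in hilbert_space) proj_subspaceI:
  assumes U: "subspace U" and p: "p \<in> U" and orth: "x - p \<in> orth ip U"
  shows "proj U x = p"
proof -
  have pyth: "(norm (x - y))\<^sup>2 = (norm (x - p))\<^sup>2 + (norm (p - y))\<^sup>2" if "y \<in> U" for y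
  proof -
    have "p - y \<in> U" using U p that by (simp add: subspace_diff)
    then have 1: "ip (x - p) (p - y) = 0" using orth by (auto simp: orth_def)
    then have 2: "ip (p - y) (x - p) = 0"
      using ip_conjugate[of "p - y" "x - p"] conjugate_of_real[of 0, where 'k='k] by simp
    have add_right: "ip u (v + w) = ip u v + ip u w" for u v w
      by (metis conjugate_add ip_add_left ip_conjugate)
    have "ip ((x - p) + (p - y)) ((x - p) + (p - y)) = ip (x - p) (x - p) + ip (p - y) (p - y)"
      using 1 2 by (simp only: ip_add_left add_right) simp
    then have "(of_real ((norm (x - y))\<^sup>2) :: 'k) = of_real ((norm (x - p))\<^sup>2 + (norm (p - y))\<^sup>2)"
      by (simp add: ip_self)
    then show ?thesis by (simp only: of_real_eq_iff)
  qed
  show ?thesis unfolding proj_def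
  proof (rule the_equality)
    have "dist x p \<le> dist x y" if "y \<in> U" for y
      unfolding dist_norm by (rule power2_le_imp_le) (simp_all add: pyth[OF that])
    then show "p \<in> U \<and> (\<forall>y\<in>U. dist x p \<le> dist x y)" using p by blast
  next
    fix q assume q: "q \<in> U \<and> (\<forall>y\<in>U. dist x q \<le> dist x y)"
    then have "(norm (x - q))\<^sup>2 \<le> (norm (x - p))\<^sup>2"
      using p by (simp add: dist_norm power_mono)
    then show "q = p" using pyth[of q] q by simp
  qed
qed


section \<open>The inverse best approximation property\<close>

definition ibap :: "nat \<Rightarrow> (nat \<Rightarrow> 'a::metric_space set) \<Rightarrow> bool"
  where "ibap m U \<longleftrightarrow>
    (\<forall>u. (\<forall>i\<in>{1..m}. u i \<in> U i) \<longrightarrow> (\<exists>x. \<forall>i\<in>{1..m}. proj (U i) x = u i))"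

definition solutions :: "nat \<Rightarrow> (nat \<Rightarrow> 'a::metric_space set) \<Rightarrow> (nat \<Rightarrow> 'a) \<Rightarrow> 'a set"
  where "solutions m U u = {x. \<forall>i\<in>{1..m}. proj (U i) x = u i}"

text \<open>The sum is the Minkowski sum of sets, with value \<open>{0}\<close> if \<open>i \<ge> m\<close>.\<close>

definition tail_sum :: "nat \<Rightarrow> (nat \<Rightarrow> 'a::comm_monoid_add set) \<Rightarrow> nat \<Rightarrow> 'a set"
  where "tail_sum m U i = (\<Sum>j\<in>{i+1..m}. U j)"

definition angle_cos ::
    "('a \<Rightarrow> 'a \<Rightarrow> 'k::real_normed_field) \<Rightarrow> 'a::real_normed_vector set \<Rightarrow> 'a set \<Rightarrow> real"
  where "angle_cos ip U V =
    Sup {norm (ip x y) | x y. x \<in> U \<inter> orth ip (U \<inter> V) \<and> y \<in> V \<inter> orth ip (U \<inter> V) \<and>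
                               norm x \<le> 1 \<and> norm y \<le> 1}"

definition affine_proj ::
    "('a \<Rightarrow> 'a \<Rightarrow> 'k::zero) \<Rightarrow> (nat \<Rightarrow> 'a::real_normed_vector set) \<Rightarrow> (nat \<Rightarrow> 'a) \<Rightarrow> nat \<Rightarrow> 'a \<Rightarrow> 'a"
  where "affine_proj ip U u i = proj (u i +o orth ip (U i))"

end

theory Submission
  imports Defs
begin

text \<open>
  Put \<open>M\<^sub>i = U\<^sub>i\<^sup>\<bottom>\<close> and let \<open>N\<^sub>k\<close> be the intersection of the \<open>M\<^sub>i\<close> with \<open>i > k\<close>, which is the
  orthogonal complement of the tail sum. If \<open>b\<close> solves all the equations \<open>P\<^sub>i b = u\<^sub>i\<close>, translation
  by \<open>b\<close> turns each affine projector \<open>Q\<^sub>i\<close> into the linear projector onto \<open>M\<^sub>i\<close>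
  (\<open>foldr_affine_proj_eq\<close>). The solution set is \<open>b + N\<^sub>0\<close>, so for the best approximation \<open>b\<close> to
  \<open>r\<close> the error \<open>x\<^sub>n - b\<close> starts in \<open>N\<^sub>0\<^sup>\<bottom>\<close>. It stays there, and every sweep applies to it
  the product of the projectors onto \<open>M\<^sub>1, \<dots>, M\<^sub>m\<close>. Two facts remain.

  The first is that this product has norm at most \<open>\<alpha>\<close> on \<open>N\<^sub>0\<^sup>\<bottom>\<close> (\<open>sweep_contracts\<close>; the estimate of
  Smith, Solmon and Wagner). Split a vector orthogonal to \<open>N\<^sub>k\<close> along \<open>N\<^sub>k\<^sub>+\<^sub>1\<close> and its complement.
  The projectors with index above \<open>k + 1\<close> fix the first part and contract the second by induction; the
  projector onto \<open>M\<^sub>k\<^sub>+\<^sub>1\<close> then shortens the first part because its angle with \<open>N\<^sub>k\<^sub>+\<^sub>1\<close> is positive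
  (\<open>norm_proj_sum_sq_le\<close>).

  The second is that every cosine is less than \<open>1\<close>. For given \<open>h\<close>, the inverse best approximation
  property provides an \<open>x\<close> with \<open>P\<^sub>i x = 0\<close> and \<open>P\<^sub>j x = P\<^sub>j h\<close> for \<open>j > i\<close>, whence
  \<open>h = x + (h - x) \<in> M\<^sub>i + N\<^sub>i\<close>. Thus \<open>M\<^sub>i + N\<^sub>i\<close> is the whole space. By uniform boundedness, two
  closed subspaces with this property have complements \<open>U, W\<close> on which \<open>u + w\<close> controls \<open>u\<close>
  (\<open>orth_complements_bounded_below\<close>), and this separation of the complements passes back to the
  subspaces themselves (\<open>angle_cos_less_1\<close>).
\<close>

section \<open>Inner product calculus\<close>

context hilbert_space
begin

lemma conjugate_mult: "conjugate (a * b) = conjugate a * conjugate (b::'k)"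
proof (cases "a = 0 \<or> b = 0")
  case True
  then show ?thesis using conjugate_of_real[of 0, where 'k='k] by auto
next
  case False
  have "(a * b) * conjugate (a * b) = (a * conjugate a) * (b * conjugate b)"
    by (simp add: mult_conjugate norm_mult power_mult_distrib)
  then have "(a * b) * conjugate (a * b) = (a * b) * (conjugate a * conjugate b)"
    by (simp add: mult_ac)
  with False show ?thesis by simp
qed

lemma ip_add_right: "ip x (y + z) = ip x y + ip x z"
  by (metis conjugate_add ip_add_left ip_conjugate)

lemma ip_scale_right: "ip x (scale c y) = conjugate c * ip x y"
  by (metis conjugate_mult ip_scale_left ip_conjugate)

lemma ip_zero_left [simp]: "ip 0 x = 0"
  using ip_add_left[of 0 0 x] by simp

lemma ip_zero_right [simp]: "ip x 0 = 0"
  using ip_add_right[of x 0 0] by simp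

lemma ip_diff_left: "ip (x - y) z = ip x z - ip y z"
  using ip_add_left[of "x - y" y z] by simp

lemma ip_diff_right: "ip z (x - y) = ip z x - ip z y"
  using ip_add_right[of z "x - y" y] by simp

lemma norm_ip_self: "norm (ip x x) = (norm x)\<^sup>2"
  by (simp only: ip_self norm_of_real) simp

lemma ip_eq_zero_commute: "ip x y = 0 \<longleftrightarrow> ip y x = 0"
  by (metis conjugate_of_real ip_conjugate of_real_0)

lemma norm_add_sq:
  assumes "ip x y = 0"
  shows "(norm (x + y))\<^sup>2 = (norm x)\<^sup>2 + (norm y)\<^sup>2"
proof -
  have "ip y x = 0" using assms ip_eq_zero_commute by blast
  then have "ip (x + y) (x + y) = ip x x + ip y y"
    using assms by (simp add: ip_add_left ip_add_right)
  then have "(of_real ((norm (x + y))\<^sup>2) :: 'k) = of_real ((norm x)\<^sup>2 + (norm y)\<^sup>2)"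
    by (simp add: ip_self)
  then show ?thesis by (simp only: of_real_eq_iff)
qed

lemma norm_scale [simp]: "norm (scale c x) = norm c * norm x"
proof -
  have "ip (scale c x) (scale c x) = (c * conjugate c) * ip x x"
    by (simp add: ip_scale_left ip_scale_right mult_ac)
  then have "(of_real ((norm (scale c x))\<^sup>2) :: 'k) = of_real ((norm c * norm x)\<^sup>2)"
    by (simp add: ip_self mult_conjugate power_mult_distrib)
  then have "(norm (scale c x))\<^sup>2 = (norm c * norm x)\<^sup>2"
    by (simp only: of_real_eq_iff)
  then show ?thesis by simp
qed

text \<open>
  Pythagoras for the splitting of \<open>x\<close> along \<open>y\<close>. Both the Cauchy--Schwarz inequality and the
  orthogonality of a nearest-point residual are read off from it.
\<close>

lemma norm_diff_component_sq:
  assumes "y \<noteq> 0"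
  shows "(norm x)\<^sup>2 =
    (norm (x - scale (ip x y / of_real ((norm y)\<^sup>2)) y))\<^sup>2 + (norm (ip x y) / norm y)\<^sup>2"
proof -
  define c where "c = ip x y / of_real ((norm y)\<^sup>2)"
  have "c * of_real ((norm y)\<^sup>2) = ip x y" using assms by (simp add: c_def)
  then have "ip (x - scale c y) y = 0"
    by (simp add: ip_diff_left ip_scale_left ip_self)
  then have "ip (x - scale c y) (scale c y) = 0" by (simp add: ip_scale_right)
  from norm_add_sq[OF this] have "(norm x)\<^sup>2 = (norm (x - scale c y))\<^sup>2 + (norm c * norm y)\<^sup>2"
    by simp
  moreover have "norm c * norm y = norm (ip x y) / norm y"
    using assms by (simp add: c_def norm_divide norm_mult power2_eq_square)
  ultimately show ?thesis by (simp add: c_def)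
qed

lemma norm_ip_le: "norm (ip x y) \<le> norm x * norm y"
proof (cases "y = 0")
  case False
  have "(norm (ip x y) / norm y)\<^sup>2 \<le> (norm x)\<^sup>2"
    using norm_diff_component_sq[OF False, of x] by simp
  then have "norm (ip x y) / norm y \<le> norm x"
    by (simp add: power2_le_iff_abs_le)
  with False show ?thesis by (simp add: divide_simps)
qed simp

lemma parallelogram: "(norm (x + y :: 'a))\<^sup>2 + (norm (x - y))\<^sup>2 = 2 * (norm x)\<^sup>2 + 2 * (norm y)\<^sup>2"
proof -
  have "ip (x + y) (x + y) + ip (x - y) (x - y) = (1 + 1) * ip x x + (1 + 1) * ip y y"
    by (simp only: ip_add_left ip_add_right ip_diff_left ip_diff_right) (simp add: algebra_simps)
  then have "(of_real ((norm (x + y))\<^sup>2 + (norm (x - y))\<^sup>2) :: 'k) =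
      of_real (2 * (norm x)\<^sup>2 + 2 * (norm y)\<^sup>2)"
    by (simp add: ip_self)
  then show ?thesis by (simp only: of_real_eq_iff)
qed


lemma tendsto_ip_left:
  assumes "f \<longlonglongrightarrow> a"
  shows "(\<lambda>n. ip (f n) z) \<longlonglongrightarrow> ip a z"
proof -
  have "(\<lambda>n. norm (f n - a) * norm z) \<longlonglongrightarrow> 0"
    using assms LIM_zero tendsto_mult_left_zero tendsto_norm_zero by blast
  then have "(\<lambda>n. ip (f n) z - ip a z) \<longlonglongrightarrow> 0"
  proof (rule Lim_null_comparison[rotated], intro always_eventually allI)
    show "norm (ip (f n) z - ip a z) \<le> norm (f n - a) * norm z" for n
      using norm_ip_le[of "f n - a" z] by (simp add: ip_diff_left)
  qed
  then show ?thesis using LIM_zero_iff by blast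
qed

text \<open>
  The Banach--Steinhaus theorem for the functionals \<open>\<lambda>h. ip h z\<close>. The sets of those \<open>h\<close> on which all
  of them are bounded by \<open>n\<close> are closed and cover the space, so by Baire one of them contains a ball;
  moving from its centre in the direction of \<open>z\<close> bounds \<open>norm z\<close>.
\<close>

lemma uniform_boundedness:
  assumes "\<And>h. \<exists>b. \<forall>z\<in>Z. norm (ip h z) \<le> b"
  shows "\<exists>C. \<forall>z\<in>Z. norm z \<le> C"
proof -
  define F where "F n = {h. \<forall>z\<in>Z. norm (ip h z) \<le> real n}" for n
  have closed: "closed (F n)" for n
    unfolding closed_sequential_limits
  proof (intro allI impI)
    fix f l assume "(\<forall>k. f k \<in> F n) \<and> f \<longlonglongrightarrow> l"
    then have f: "\<And>k z. z \<in> Z \<Longrightarrow> norm (ip (f k) z) \<le> real n" and l: "f \<longlonglongrightarrow> l"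
      by (auto simp: F_def)
    have "norm (ip l z) \<le> real n" if "z \<in> Z" for z
      by (rule LIMSEQ_le_const2[OF tendsto_norm[OF tendsto_ip_left[OF l]]]) (use f[OF that] in blast)
    then show "l \<in> F n" by (simp add: F_def)
  qed
  have cover: "(\<Union>n. F n) = UNIV"
  proof -
    have "h \<in> (\<Union>n. F n)" for h
    proof -
      obtain b where b: "\<forall>z\<in>Z. norm (ip h z) \<le> b" using assms by blast
      obtain n where "b \<le> real n" using real_arch_simple by blast
      with b have "h \<in> F n" unfolding F_def by (blast intro: order_trans)
      then show ?thesis by blast
    qed
    then show ?thesis by auto
  qed
  have "\<exists>n. interior (F n) \<noteq> {}"
  proof (rule ccontr)
    assume "\<not> (\<exists>n. interior (F n) \<noteq> {})"
    then have "euclidean interior_of (\<Union>(range F)) = {}"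
      using closed completely_metrizable_space_euclidean
      by (intro Baire_category_alt) auto
    with cover show False by simp
  qed
  then obtain n h where "h \<in> interior (F n)" by blast
  then obtain e where e: "e > 0" "cball h e \<subseteq> F n"
    by (meson mem_interior_cball)
  have "norm z \<le> 2 * real n / e" if z: "z \<in> Z" for z
  proof (cases "z = 0")
    case False
    define k where "k = (e / norm z) *\<^sub>R z"
    have "norm k = e" using False e by (simp add: k_def)
    then have "h \<in> F n" "h + k \<in> F n" using e by (auto simp: dist_norm)
    then have "norm (ip h z) \<le> real n" "norm (ip (h + k) z) \<le> real n"
      using z by (auto simp: F_def)
    then have "norm (ip k z) \<le> 2 * real n"
      using norm_triangle_ineq4[of "ip (h + k) z" "ip h z"] by (simp add: ip_add_left)
    moreover have "norm (ip k z) = e * norm z"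
    proof -
      have "ip k z = of_real (e / norm z) * of_real ((norm z)\<^sup>2)"
        unfolding k_def scale_of_real[symmetric] by (simp only: ip_scale_left ip_self)
      then have "ip k z = of_real (e * norm z)"
        using False by (simp only: of_real_mult[symmetric]) (simp add: power2_eq_square)
      then show ?thesis using e by (simp only: norm_of_real) simp
    qed
    ultimately show ?thesis using e by (simp add: field_simps)
  qed (use e in simp)
  then show ?thesis by blast
qed


section \<open>Orthogonal complements and projectors\<close>

lemma subspace_orth: "subspace (orth ip S)"
  by (rule subspaceI) (auto simp: orth_def ip_add_left ip_scale_left)

lemma closed_orth: "closed (orth ip S)"
  unfolding closed_sequential_limits
proof (intro allI impI)
  fix f l assume "(\<forall>k. f k \<in> orth ip S) \<and> f \<longlonglongrightarrow> l"
  then have f: "\<And>k z. z \<in> S \<Longrightarrow> ip (f k) z = 0" and l: "f \<longlonglongrightarrow> l"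
    by (auto simp: orth_def)
  have "ip l z = 0" if "z \<in> S" for z
    using tendsto_ip_left[OF l, of z] f[OF that] by (simp add: LIMSEQ_const_iff)
  then show "l \<in> orth ip S" by (simp add: orth_def)
qed

lemma orth_antimono: "S \<subseteq> T \<Longrightarrow> orth ip T \<subseteq> orth ip S"
  by (auto simp: orth_def)

lemma mem_orth_orth: "x \<in> S \<Longrightarrow> x \<in> orth ip (orth ip S)"
  by (auto simp: orth_def ip_eq_zero_commute)

text \<open>
  By the parallelogram law a minimizing sequence is Cauchy: the midpoint of two almost nearest points
  lies in \<open>M\<close> and so cannot be much nearer, which forces the two points together.
\<close>

lemma nearest_point_exists:
  assumes M: "subspace M" and cl: "closed M"
  shows "\<exists>p\<in>M. \<forall>y\<in>M. norm (x - p) \<le> norm (x - y)"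
proof -
  define d where "d = infdist x M"
  have ne: "M \<noteq> {}" using subspace_0[OF M] by blast
  have d0: "0 \<le> d" and dle: "\<And>y. y \<in> M \<Longrightarrow> d \<le> norm (x - y)"
    by (simp_all add: d_def infdist_nonneg infdist_le flip: dist_norm)
  have "\<exists>y\<in>M. (norm (x - y))\<^sup>2 < d\<^sup>2 + inverse (real (Suc n))" for n
  proof -
    have "d < sqrt (d\<^sup>2 + inverse (real (Suc n)))"
      by (rule real_less_rsqrt) simp
    then obtain y where "y \<in> M" "dist x y < sqrt (d\<^sup>2 + inverse (real (Suc n)))"
      using ne cINF_less_iff[of M "dist x"] by (auto simp: d_def infdist_notempty)
    moreover have "(norm (x - y))\<^sup>2 < (sqrt (d\<^sup>2 + inverse (real (Suc n))))\<^sup>2"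
      using calculation(2) by (intro power_strict_mono) (auto simp: dist_norm)
    moreover have "0 \<le> d\<^sup>2 + inverse (real (Suc n))" by simp
    ultimately show ?thesis by (metis real_sqrt_pow2)
  qed
  then obtain y where y: "\<And>n. y n \<in> M"
      and yd: "\<And>n. (norm (x - y n))\<^sup>2 < d\<^sup>2 + inverse (real (Suc n))"
    by metis
  have gap: "(norm (y k - y n))\<^sup>2 \<le> 2 * inverse (real (Suc k)) + 2 * inverse (real (Suc n))" for k n
  proof -
    define w where "w = scale (of_real (1/2)) (y k + y n)"
    have "w \<in> M" using M y by (simp add: w_def subspace_add subspace_scale)
    have "2 *\<^sub>R w = y k + y n" by (simp only: w_def scale_of_real) simp
    then have "(x - y k) + (x - y n) = 2 *\<^sub>R (x - w)"
      by (simp add: algebra_simps scaleR_2)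
    then have "norm ((x - y k) + (x - y n)) = 2 * norm (x - w)" by simp
    then have "4 * d\<^sup>2 \<le> (norm ((x - y k) + (x - y n)))\<^sup>2"
      using power_mono[OF dle[OF \<open>w \<in> M\<close>] d0, of 2] by (simp add: power_mult_distrib)
    moreover have "norm ((x - y k) - (x - y n)) = norm (y k - y n)"
      by (simp add: norm_minus_commute)
    ultimately show ?thesis
      using parallelogram[of "x - y k" "x - y n"] yd[of k] yd[of n] by simp
  qed
  have "Cauchy y"
  proof (rule CauchyI)
    fix e :: real assume "0 < e"
    then have "0 < e\<^sup>2 / 4" by simp
    then obtain N where N: "inverse (real (Suc N)) < e\<^sup>2 / 4" using reals_Archimedean by blast
    have small: "inverse (real (Suc k)) < e\<^sup>2 / 4" if "N \<le> k" for k
      using that N by (smt (verit) le_imp_inverse_le of_nat_0_less_iff of_nat_mono Suc_le_mono zero_less_Suc)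
    have "norm (y k - y n) < e" if "N \<le> k" "N \<le> n" for k n
    proof (rule power2_less_imp_less)
      show "(norm (y k - y n))\<^sup>2 < e\<^sup>2"
        using gap[of k n] small[OF that(1)] small[OF that(2)] by linarith
    qed (use \<open>0 < e\<close> in simp)
    then show "\<exists>N. \<forall>k\<ge>N. \<forall>n\<ge>N. norm (y k - y n) < e" by blast
  qed
  then obtain p where p: "y \<longlonglongrightarrow> p" using Cauchy_convergent convergentD by blast
  have "p \<in> M" using cl y p closed_sequentially by blast
  have "(\<lambda>n. (norm (x - y n))\<^sup>2) \<longlonglongrightarrow> (norm (x - p))\<^sup>2"
    by (intro tendsto_intros p)
  moreover have "(\<lambda>n. d\<^sup>2 + inverse (real (Suc n))) \<longlonglongrightarrow> d\<^sup>2 + 0"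
    by (intro tendsto_intros LIMSEQ_inverse_real_of_nat)
  ultimately have "(norm (x - p))\<^sup>2 \<le> d\<^sup>2 + 0"
    using yd by (intro LIMSEQ_le) (auto intro: less_imp_le)
  then have "norm (x - p) \<le> d" by (intro power2_le_imp_le[OF _ d0]) simp
  then show ?thesis using \<open>p \<in> M\<close> dle by (meson order_trans)
qed

lemma nearest_point_residual_orth:
  assumes M: "subspace M" and p: "p \<in> M" and near: "\<And>y. y \<in> M \<Longrightarrow> norm (x - p) \<le> norm (x - y)"
  shows "x - p \<in> orth ip M"
proof -
  have "ip (x - p) y = 0" if y: "y \<in> M" for y
  proof (cases "y = 0")
    case False
    define c where "c = ip (x - p) y / of_real ((norm y)\<^sup>2)"
    have "p + scale c y \<in> M" using M p y by (simp add: subspace_add subspace_scale)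
    then have "(norm (x - p))\<^sup>2 \<le> (norm ((x - p) - scale c y))\<^sup>2"
      using near by (metis diff_diff_add norm_ge_zero power_mono)
    then have "(norm (ip (x - p) y) / norm y)\<^sup>2 \<le> 0"
      using norm_diff_component_sq[OF False, of "x - p"] by (simp add: c_def)
    with False show ?thesis by simp
  qed simp
  then show ?thesis by (simp add: orth_def)
qed

definition closed_subspace :: "'a set \<Rightarrow> bool"
  where "closed_subspace M \<longleftrightarrow> subspace M \<and> closed M"

lemma closed_subspace_orth: "closed_subspace (orth ip S)"
  by (simp add: closed_subspace_def subspace_orth closed_orth)

lemma proj_decomposition:
  assumes "closed_subspace M"
  shows "proj M x \<in> M" "x - proj M x \<in> orth ip M"
proof -
  have M: "subspace M" "closed M" using assms by (auto simp: closed_subspace_def)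
  obtain p where p: "p \<in> M" "\<forall>y\<in>M. norm (x - p) \<le> norm (x - y)"
    using nearest_point_exists[OF M] by blast
  then have "x - p \<in> orth ip M" using nearest_point_residual_orth[OF M(1)] by blast
  moreover from this have "proj M x = p" using proj_subspaceI[OF M(1)] p by blast
  ultimately show "proj M x \<in> M" "x - proj M x \<in> orth ip M" using p by auto
qed

lemma proj_eqI: "closed_subspace M \<Longrightarrow> p \<in> M \<Longrightarrow> x - p \<in> orth ip M \<Longrightarrow> proj M x = p"
  by (simp add: closed_subspace_def proj_subspaceI)

lemma proj_self: "closed_subspace M \<Longrightarrow> x \<in> M \<Longrightarrow> proj M x = x"
  by (rule proj_eqI) (auto simp: orth_def)

lemma orth_orth:
  assumes "closed_subspace M"
  shows "orth ip (orth ip M) = M"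
proof
  show "orth ip (orth ip M) \<subseteq> M"
  proof
    fix x assume x: "x \<in> orth ip (orth ip M)"
    note d = proj_decomposition[OF assms, of x]
    have "ip x (x - proj M x) = 0" using x d by (auto simp: orth_def)
    moreover have "ip (proj M x) (x - proj M x) = 0"
      using d by (auto simp: orth_def ip_eq_zero_commute)
    ultimately have "ip (x - proj M x) (x - proj M x) = 0"
      by (simp add: ip_diff_left)
    then have "x - proj M x = 0" by (simp add: ip_self)
    with d show "x \<in> M" by simp
  qed
qed (use mem_orth_orth in blast)

lemma norm_proj_sq:
  assumes "closed_subspace M"
  shows "(norm x)\<^sup>2 = (norm (proj M x))\<^sup>2 + (norm (x - proj M x))\<^sup>2"
proof -
  have "ip (proj M x) (x - proj M x) = 0"
    using proj_decomposition[OF assms, of x] by (auto simp: orth_def ip_eq_zero_commute)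
  from norm_add_sq[OF this] show ?thesis by simp
qed

lemma proj_add:
  assumes "closed_subspace M"
  shows "proj M (x + y) = proj M x + proj M y"
proof -
  note dx = proj_decomposition[OF assms, of x] and dy = proj_decomposition[OF assms, of y]
  have M: "subspace M" using assms by (simp add: closed_subspace_def)
  have "(x - proj M x) + (y - proj M y) \<in> orth ip M"
    using dx dy subspace_orth subspace_add by blast
  then show ?thesis
    using dx dy M by (intro proj_eqI[OF assms]) (auto simp: subspace_add algebra_simps)
qed

lemma ip_proj_right:
  assumes "closed_subspace M" "x \<in> M"
  shows "ip x (proj M y) = ip x y"
proof -
  have "ip x (y - proj M y) = 0"
    using proj_decomposition[OF assms(1), of y] assms(2) by (auto simp: orth_def ip_eq_zero_commute)
  then show ?thesis by (simp add: ip_diff_right)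
qed

lemma ip_proj_left:
  assumes "closed_subspace M" "y \<in> M"
  shows "ip (proj M x) y = ip x y"
  by (metis assms ip_conjugate ip_proj_right)


section \<open>The cosine of the angle between two subspaces\<close>

lemma angle_cos_bounded:
  "bdd_above {norm (ip x y) | x y. x \<in> A \<inter> orth ip (A \<inter> B) \<and> y \<in> B \<inter> orth ip (A \<inter> B) \<and>
     norm x \<le> 1 \<and> norm y \<le> 1}"
proof (rule bdd_aboveI)
  fix t assume "t \<in> {norm (ip x y) | x y. x \<in> A \<inter> orth ip (A \<inter> B) \<and>
    y \<in> B \<inter> orth ip (A \<inter> B) \<and> norm x \<le> 1 \<and> norm y \<le> 1}"
  then obtain x y where "t = norm (ip x y)" "norm x \<le> 1" "norm y \<le> 1" by blast
  then show "t \<le> 1"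
    using norm_ip_le[of x y] mult_mono[of "norm x" 1 "norm y" 1] by simp
qed

lemma angle_cos_nonneg:
  assumes "0 \<in> A" "0 \<in> B"
  shows "0 \<le> angle_cos ip A B"
  unfolding angle_cos_def
proof (rule cSup_upper[OF _ angle_cos_bounded], clarify, intro exI conjI)
  show "0 = norm (ip 0 0)" by simp
qed (use assms in \<open>auto simp: orth_def\<close>)

lemma angle_cos_leI:
  assumes "0 \<in> A" "0 \<in> B"
    and "\<And>x y. x \<in> A \<Longrightarrow> x \<in> orth ip (A \<inter> B) \<Longrightarrow> y \<in> B \<Longrightarrow> y \<in> orth ip (A \<inter> B) \<Longrightarrow>
           norm x \<le> 1 \<Longrightarrow> norm y \<le> 1 \<Longrightarrow> norm (ip x y) \<le> c"
  shows "angle_cos ip A B \<le> c"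
  unfolding angle_cos_def
proof (rule cSup_least)
  have "0 \<in> orth ip (A \<inter> B)" by (simp add: orth_def)
  then show "{norm (ip x y) | x y. x \<in> A \<inter> orth ip (A \<inter> B) \<and> y \<in> B \<inter> orth ip (A \<inter> B) \<and>
     norm x \<le> 1 \<and> norm y \<le> 1} \<noteq> {}"
    using assms(1,2) norm_zero zero_le_one by (metis (mono_tags, lifting) IntI empty_Collect_eq)
qed (use assms(3) in blast)

lemma angle_cos_UNIV: "0 \<in> A \<Longrightarrow> angle_cos ip A UNIV = 0"
proof (rule antisym[OF angle_cos_leI angle_cos_nonneg])
  fix x y assume "x \<in> A" "x \<in> orth ip (A \<inter> UNIV)"
  then have "ip x x = 0" by (simp add: orth_def)
  then have "x = 0" by (simp add: ip_self)
  then show "norm (ip x y) \<le> 0" by simp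
qed simp_all

lemma norm_ip_le_angle_cos:
  assumes A: "subspace A" and B: "subspace B"
    and x: "x \<in> A" "x \<in> orth ip (A \<inter> B)" and y: "y \<in> B" "y \<in> orth ip (A \<inter> B)"
  shows "norm (ip x y) \<le> angle_cos ip A B * (norm x * norm y)"
proof (cases "x = 0 \<or> y = 0")
  case False
  define a where "a = (of_real (inverse (norm x)) :: 'k)"
  define b where "b = (of_real (inverse (norm y)) :: 'k)"
  have a: "norm a = inverse (norm x)" and b: "norm b = inverse (norm y)"
    unfolding a_def b_def norm_of_real by simp_all
  have "norm (scale a x) = 1" "norm (scale b y) = 1"
    using False by (simp_all add: a b)
  moreover have "scale a x \<in> A \<inter> orth ip (A \<inter> B)" "scale b y \<in> B \<inter> orth ip (A \<inter> B)"
    using A B x y subspace_orth subspace_scale by blast+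
  ultimately have "norm (ip (scale a x) (scale b y)) \<le> angle_cos ip A B"
    unfolding angle_cos_def by (intro cSup_upper[OF _ angle_cos_bounded]) (auto intro!: exI)
  moreover have "norm (ip (scale a x) (scale b y)) = norm (ip x y) / (norm x * norm y)"
  proof -
    have "conjugate b = b" by (simp only: b_def conjugate_of_real)
    then have "norm (ip (scale a x) (scale b y)) = norm a * norm b * norm (ip x y)"
      by (simp add: ip_scale_left ip_scale_right norm_mult)
    then show ?thesis by (simp add: a b field_simps)
  qed
  ultimately show ?thesis using False by (simp add: divide_simps)
qed auto

text \<open>
  The form in which the angle enters the convergence rate: on the part of \<open>A\<close> orthogonal to the
  intersection, the projector onto \<open>B\<close> has norm at most the cosine, because the projection of \<open>x\<close> is
  itself orthogonal to \<open>A \<inter> B\<close> and its squared norm is its inner product with \<open>x\<close>.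
\<close>

lemma norm_proj_le_angle_cos:
  assumes A: "subspace A" and B: "closed_subspace B"
    and x: "x \<in> A" "x \<in> orth ip (A \<inter> B)"
  shows "norm (proj B x) \<le> angle_cos ip A B * norm x"
proof (cases "proj B x = 0")
  case False
  note d = proj_decomposition[OF B, of x]
  have "x - proj B x \<in> orth ip (A \<inter> B)" using d orth_antimono by blast
  then have "x - (x - proj B x) \<in> orth ip (A \<inter> B)"
    using x(2) subspace_orth subspace_diff by blast
  then have "norm (ip x (proj B x)) \<le> angle_cos ip A B * (norm x * norm (proj B x))"
    using A B x d by (intro norm_ip_le_angle_cos) (auto simp: closed_subspace_def)
  moreover have "ip x (proj B x) = ip (proj B x) (proj B x)"
    using ip_proj_left[OF B d(1)] by simp
  ultimately have "norm (proj B x) * norm (proj B x) \<le> (angle_cos ip A B * norm x) * norm (proj B x)"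
    by (simp add: norm_ip_self power2_eq_square mult_ac)
  with False show ?thesis by simp
next
  case True
  have "0 \<le> angle_cos ip A B"
    using A B by (intro angle_cos_nonneg) (auto simp: closed_subspace_def subspace_0)
  with True show ?thesis by simp
qed

text \<open>
  If \<open>h = a + b\<close>, then \<open>ip h u = ip b (u + w)\<close>, as \<open>u\<close> is orthogonal to \<open>a\<close> and \<open>w\<close> to \<open>b\<close>. Hence the
  vectors \<open>u\<close> with \<open>norm (u + w) \<le> 1\<close> are pointwise bounded functionals, and uniform boundedness
  applies. This takes the place of an open mapping argument for \<open>A + B\<close>.
\<close>

lemma orth_complements_bounded_below:
  assumes sum: "\<And>h. \<exists>a\<in>A. \<exists>b\<in>B. h = a + b"
  shows "\<exists>C\<ge>0. \<forall>u\<in>orth ip A. \<forall>w\<in>orth ip B. norm u \<le> C * norm (u + w)"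
proof -
  define Z where "Z = {u \<in> orth ip A. \<exists>w\<in>orth ip B. norm (u + w) \<le> 1}"
  have "\<exists>c. \<forall>u\<in>Z. norm (ip h u) \<le> c" for h
  proof -
    obtain a b where ab: "a \<in> A" "b \<in> B" "h = a + b" using sum by blast
    have "norm (ip h u) \<le> norm b" if "u \<in> Z" for u
    proof -
      from \<open>u \<in> Z\<close> obtain w where w: "u \<in> orth ip A" "w \<in> orth ip B" "norm (u + w) \<le> 1"
        by (auto simp: Z_def)
      then have "ip a u = 0" "ip b w = 0"
        using ab by (auto simp: orth_def ip_eq_zero_commute[of a] ip_eq_zero_commute[of b])
      then have "ip h u = ip b (u + w)" by (simp add: ab ip_add_left ip_add_right)
      then have "norm (ip h u) \<le> norm b * norm (u + w)" using norm_ip_le by simp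
      also have "\<dots> \<le> norm b" using w(3) by (simp add: mult_left_le)
      finally show ?thesis .
    qed
    then show ?thesis by blast
  qed
  then obtain C where C: "\<And>u. u \<in> Z \<Longrightarrow> norm u \<le> C" using uniform_boundedness by blast
  have "0 \<in> Z"
    unfolding Z_def by (intro CollectI conjI bexI[of _ 0]) (simp_all add: orth_def)
  then have "0 \<le> C" using C by fastforce
  have "norm u \<le> C * norm (u + w)" if u: "u \<in> orth ip A" and w: "w \<in> orth ip B" for u w
  proof (cases "u + w = 0")
    case False
    define t where "t = inverse (norm (u + w))"
    have "t > 0" using False by (simp add: t_def)
    have "t *\<^sub>R u \<in> orth ip A" "t *\<^sub>R w \<in> orth ip B"
      using u w subspace_orth subspace_scale unfolding scale_of_real[symmetric] by blast+
    moreover have "norm (t *\<^sub>R u + t *\<^sub>R w) \<le> 1"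
      using False by (simp add: t_def flip: scaleR_add_right)
    ultimately have "t *\<^sub>R u \<in> Z" by (auto simp: Z_def)
    then have "t * norm u \<le> C" using C \<open>t > 0\<close> by fastforce
    then show ?thesis using False by (simp add: t_def field_simps)
  next
    case True
    \<comment> \<open>All positive multiples of \<open>u\<close> belong to \<open>Z\<close>, so boundedness forces \<open>u = 0\<close>.\<close>
    have "t * norm u \<le> C" if "t > 0" for t
    proof -
      have "t *\<^sub>R u \<in> orth ip A" "t *\<^sub>R w \<in> orth ip B"
        using u w subspace_orth subspace_scale unfolding scale_of_real[symmetric] by blast+
      moreover have "t *\<^sub>R u + t *\<^sub>R w = 0" using True by (simp flip: scaleR_add_right)
      ultimately have "t *\<^sub>R u \<in> Z"
        unfolding Z_def by (intro CollectI conjI bexI[of _ "t *\<^sub>R w"]) simp_all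
      then show ?thesis using C that by fastforce
    qed
    from this[of "(C + 1) / norm u"] have "norm u = 0"
      using \<open>0 \<le> C\<close> by (cases "u = 0") auto
    then show ?thesis using True by simp
  qed
  with \<open>0 \<le> C\<close> show ?thesis by blast
qed

text \<open>
  Under the estimate a convergent sequence of sums has convergent summands.
\<close>

lemma closed_sum_of_subspaces:
  assumes U: "closed_subspace U" and W: "closed_subspace W"
    and C: "\<And>u w. u \<in> U \<Longrightarrow> w \<in> W \<Longrightarrow> norm u \<le> C * norm (u + w)"
  shows "closed_subspace {u + w | u w. u \<in> U \<and> w \<in> W}"
proof -
  have sU: "subspace U" and sW: "subspace W" and cU: "closed U" and cW: "closed W"
    using U W by (auto simp: closed_subspace_def)
  have "closed {u + w | u w. u \<in> U \<and> w \<in> W}"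
    unfolding closed_sequential_limits
  proof (intro allI impI)
    fix f l assume "(\<forall>n. f n \<in> {u + w | u w. u \<in> U \<and> w \<in> W}) \<and> f \<longlonglongrightarrow> l"
    then obtain u w where uw: "\<And>n. u n \<in> U" "\<And>n. w n \<in> W" "\<And>n. f n = u n + w n"
      and l: "f \<longlonglongrightarrow> l"
      by (simp, metis)
    have est: "norm (u j - u k) \<le> C * norm (f j - f k)" for j k
      using C[of "u j - u k" "w j - w k"] uw sU sW
      by (simp add: subspace_diff algebra_simps)
    have "Cauchy u"
    proof (rule CauchyI)
      fix e :: real assume "0 < e"
      have "0 < e / (\<bar>C\<bar> + 1)" using \<open>0 < e\<close> by simp
      then obtain N where N: "\<And>j k. N \<le> j \<Longrightarrow> N \<le> k \<Longrightarrow> norm (f j - f k) < e / (\<bar>C\<bar> + 1)"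
        using LIMSEQ_imp_Cauchy[OF l] CauchyD by blast
      have "norm (u j - u k) < e" if "N \<le> j" "N \<le> k" for j k
      proof -
        have "norm (u j - u k) \<le> (\<bar>C\<bar> + 1) * norm (f j - f k)"
          by (rule order_trans[OF est mult_right_mono]) auto
        also have "\<dots> < e" using N[OF that] by (simp add: field_simps)
        finally show ?thesis .
      qed
      then show "\<exists>N. \<forall>j\<ge>N. \<forall>k\<ge>N. norm (u j - u k) < e" by blast
    qed
    then obtain a where a: "u \<longlonglongrightarrow> a" using Cauchy_convergent convergentD by blast
    have "(\<lambda>n. f n - u n) \<longlonglongrightarrow> l - a" by (intro tendsto_diff l a)
    then have "w \<longlonglongrightarrow> l - a" using uw(3) by simp
    then have "l - a \<in> W" "a \<in> U" using cU cW a uw closed_sequentially by blast+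
    then show "l \<in> {u + w | u w. u \<in> U \<and> w \<in> W}" by force
  qed
  then show ?thesis using subspace_sums[OF sU sW] by (simp add: closed_subspace_def)
qed

text \<open>
  Let \<open>U, W\<close> be the complements of \<open>A, B\<close>. As \<open>U + W\<close> is closed, a vector \<open>x \<in> A\<close> orthogonal to
  \<open>A \<inter> B\<close> can be written \<open>x = u + w\<close>, and \<open>- u\<close> is then the projection of \<open>w\<close> onto \<open>U\<close>. For \<open>y \<in> B\<close>
  only the component of \<open>u\<close> orthogonal to \<open>W\<close> contributes to \<open>ip x y\<close>; with \<open>q\<close> the projection of \<open>u\<close>
  onto \<open>W\<close> its squared length is at most \<open>(norm u / norm w)\<^sup>2 * (norm x)\<^sup>2\<close>. The ratio
  \<open>norm u / norm w\<close> stays away from \<open>1\<close> because \<open>norm u\<close> is bounded by a multiple of \<open>norm x\<close>, and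
  \<open>(norm w)\<^sup>2 = (norm x)\<^sup>2 + (norm u)\<^sup>2\<close>.
\<close>

lemma angle_cos_less_1:
  assumes A: "closed_subspace A" and B: "closed_subspace B"
    and sum: "\<And>h. \<exists>a\<in>A. \<exists>b\<in>B. h = a + b"
  shows "angle_cos ip A B < 1"
proof -
  define U where "U = orth ip A"
  define W where "W = orth ip B"
  have U: "closed_subspace U" and W: "closed_subspace W"
    by (simp_all add: U_def W_def closed_subspace_orth)
  have UA: "orth ip U = A" and WB: "orth ip W = B"
    using A B by (simp_all add: U_def W_def orth_orth)
  obtain C where C0: "C \<ge> 0" and C: "\<And>u w. u \<in> U \<Longrightarrow> w \<in> W \<Longrightarrow> norm u \<le> C * norm (u + w)"
    using orth_complements_bounded_below[OF sum] unfolding U_def W_def by blast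
  define S where "S = {u + w | u w. u \<in> U \<and> w \<in> W}"
  have S: "closed_subspace S" unfolding S_def using closed_sum_of_subspaces[OF U W C] .
  have "orth ip S \<subseteq> A \<inter> B"
  proof -
    have "U \<subseteq> S" "W \<subseteq> S"
      using U W subspace_0 unfolding S_def closed_subspace_def by force+
    then show ?thesis using orth_antimono UA WB by blast
  qed
  then have S': "orth ip (A \<inter> B) \<subseteq> S" using orth_antimono orth_orth[OF S] by blast
  \<comment> \<open>From \<open>(norm u)\<^sup>2 \<le> C\<^sup>2 * (norm x)\<^sup>2\<close> and \<open>(norm x)\<^sup>2 = (norm w)\<^sup>2 - (norm u)\<^sup>2\<close> below.\<close>
  define g where "g = C\<^sup>2 / (1 + C\<^sup>2)"
  have g: "0 \<le> g" "g < 1" by (simp_all add: g_def field_simps add_pos_nonneg)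
  have "norm (ip x y) \<le> sqrt g"
    if x: "x \<in> A" "x \<in> orth ip (A \<inter> B)" and y: "y \<in> B" and n: "norm x \<le> 1" "norm y \<le> 1" for x y
  proof -
    obtain u w where uw: "u \<in> U" "w \<in> W" "x = u + w" using x S' by (auto simp: S_def)
    have ux: "ip u x = 0" using x uw(1) by (simp add: U_def orth_def)
    have wy: "ip w y = 0" using y uw(2) by (simp add: W_def orth_def)
    \<comment> \<open>Since \<open>x\<close> is orthogonal to \<open>u\<close>, Pythagoras applies to \<open>w = x - u\<close>.\<close>
    have w2: "(norm w)\<^sup>2 = (norm x)\<^sup>2 + (norm u)\<^sup>2"
    proof -
      have "ip x (- u) = 0" using ux ip_eq_zero_commute ip_diff_right[of x 0 u] by simp
      from norm_add_sq[OF this] show ?thesis using uw(3) by simp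
    qed
    define q where "q = proj W u"
    have u2: "(norm u)\<^sup>2 \<le> norm q * norm w"
    proof -
      have "ip u w = - ip u u" using ux by (simp add: uw(3) ip_add_right add_eq_0_iff)
      moreover have "ip q w = ip u w" unfolding q_def using W uw(2) by (rule ip_proj_left)
      ultimately show ?thesis using norm_ip_le[of q w] by (simp add: norm_ip_self)
    qed
    have "(norm u)\<^sup>2 \<le> g * (norm w)\<^sup>2"
    proof -
      have "norm u \<le> C * norm x" using C uw by simp
      then have "(norm u)\<^sup>2 \<le> C\<^sup>2 * (norm x)\<^sup>2"
        by (metis norm_ge_zero power_mono power_mult_distrib)
      then have "(norm u)\<^sup>2 * (1 + C\<^sup>2) \<le> C\<^sup>2 * (norm w)\<^sup>2"
        by (simp add: w2 algebra_simps)
      moreover have "0 < 1 + C\<^sup>2" by (simp add: add_pos_nonneg)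
      ultimately show ?thesis by (simp add: g_def field_simps)
    qed
    have uq: "(norm (u - q))\<^sup>2 \<le> g * (norm x)\<^sup>2"
    proof (cases "w = 0")
      case True
      then have "u = 0" using w2 by (simp add: sum_power2_eq_zero_iff)
      then show ?thesis using proj_self[OF W, of 0] W g
        by (simp add: q_def closed_subspace_def subspace_0)
    next
      case False
      have "((norm u)\<^sup>2)\<^sup>2 \<le> (norm q)\<^sup>2 * (norm w)\<^sup>2"
        using power_mono[OF u2, of 2] by (simp add: power_mult_distrib)
      moreover have "(norm u)\<^sup>2 = (norm q)\<^sup>2 + (norm (u - q))\<^sup>2"
        unfolding q_def using norm_proj_sq[OF W] .
      ultimately have "(norm (u - q))\<^sup>2 * (norm w)\<^sup>2 \<le> (norm u)\<^sup>2 * (norm w)\<^sup>2 - ((norm u)\<^sup>2)\<^sup>2"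
        by (simp add: algebra_simps)
      also have "\<dots> = (norm u)\<^sup>2 * (norm x)\<^sup>2"
        by (simp only: w2) (simp add: power2_eq_square algebra_simps)
      also have "\<dots> \<le> (g * (norm w)\<^sup>2) * (norm x)\<^sup>2"
        using \<open>(norm u)\<^sup>2 \<le> g * (norm w)\<^sup>2\<close> by (rule mult_right_mono) simp
      finally show ?thesis using False by (simp add: mult_ac)
    qed
    have "ip q y = 0"
      using proj_decomposition(1)[OF W, of u] y by (simp add: q_def W_def orth_def)
    then have "ip x y = ip (u - q) y"
      using wy by (simp add: uw(3) ip_add_left ip_diff_left)
    then have "norm (ip x y) \<le> norm (u - q) * norm y" using norm_ip_le by simp
    also have "\<dots> \<le> norm (u - q)" using n(2) by (simp add: mult_left_le)
    also have "\<dots> \<le> sqrt g"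
    proof (rule real_le_rsqrt)
      have "g * (norm x)\<^sup>2 \<le> g" using g n(1) by (simp add: mult_left_le power_le_one)
      with uq show "(norm (u - q))\<^sup>2 \<le> g" by linarith
    qed
    finally show ?thesis .
  qed
  then have "angle_cos ip A B \<le> sqrt g"
    using A B by (intro angle_cos_leI) (auto simp: closed_subspace_def subspace_0)
  also have "\<dots> < 1" using g by simp
  finally show ?thesis .
qed


section \<open>The rate of a sweep of projections\<close>

lemma foldr_proj_add:
  assumes "\<And>i. i \<in> set is \<Longrightarrow> closed_subspace (M i)"
  shows "foldr (\<lambda>i. proj (M i)) is (x + y) =
    foldr (\<lambda>i. proj (M i)) is x + foldr (\<lambda>i. proj (M i)) is y"
  using assms by (induction "is") (simp_all add: proj_add)

lemma foldr_proj_fixed: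
  assumes "\<And>i. i \<in> set is \<Longrightarrow> closed_subspace (M i)" and "\<And>i. i \<in> set is \<Longrightarrow> x \<in> M i"
  shows "foldr (\<lambda>i. proj (M i)) is x = x"
  using assms by (induction "is") (simp_all add: proj_self)

lemma foldr_proj_mem_orth:
  assumes "\<And>i. i \<in> set is \<Longrightarrow> closed_subspace (M i)" and "\<And>i. i \<in> set is \<Longrightarrow> S \<subseteq> M i"
    and "x \<in> orth ip S"
  shows "foldr (\<lambda>i. proj (M i)) is x \<in> orth ip S"
  using assms
proof (induction "is")
  case (Cons i "is")
  then have "foldr (\<lambda>i. proj (M i)) is x \<in> orth ip S" by simp
  moreover have "ip (proj (M i) z) s = ip z s" if "s \<in> S" for s z
    using Cons.prems that by (intro ip_proj_left) auto
  ultimately show ?case by (auto simp: orth_def)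
qed simp

text \<open>
  The inductive step of the rate estimate. In its use \<open>v\<close> and a vector of norm \<open>W\<close> are the two orthogonal
  components of a vector before the inner projections, and \<open>w\<close> is what these make of the second
  component. Let \<open>x\<close> be the projection of \<open>v + w\<close> onto \<open>M\<close> and split \<open>x\<close> along \<open>N\<close> into parts of
  lengths \<open>t\<close> and \<open>s\<close>. Then \<open>(norm x)\<^sup>2 \<le> t * norm v + s * norm w\<close>, and the angle forces
  \<open>t \<le> c * norm x\<close>, so that a definite share of \<open>x\<close> is paired with the contracted vector \<open>w\<close>.
\<close>

lemma norm_proj_sum_sq_le:
  assumes M: "closed_subspace M" and N: "closed_subspace N"
    and v: "v \<in> N" "v \<in> orth ip (M \<inter> N)" and w: "w \<in> orth ip N"
    and p: "0 \<le> p" "p \<le> 1" and W: "(norm w)\<^sup>2 \<le> (1 - p) * W\<^sup>2"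
    and c1: "angle_cos ip M N \<le> 1"
  shows "(norm (proj M (v + w)))\<^sup>2 \<le> (1 - (1 - (angle_cos ip M N)\<^sup>2) * p) * ((norm v)\<^sup>2 + W\<^sup>2)"
proof -
  define c where "c = angle_cos ip M N"
  have sM: "subspace M" and sN: "subspace N" using M N by (auto simp: closed_subspace_def)
  have c: "0 \<le> c" "c \<le> 1"
    using c1 sM sN by (auto simp: c_def intro!: angle_cos_nonneg subspace_0)
  define x where "x = proj M (v + w)"
  have xM: "x \<in> M" unfolding x_def using proj_decomposition[OF M] by blast
  have "v + w \<in> orth ip (M \<inter> N)"
    using v(2) w subspace_orth subspace_add orth_antimono by blast
  then have xMN: "x \<in> orth ip (M \<inter> N)"
    using ip_proj_left[OF M] by (auto simp: x_def orth_def)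
  define q where "q = proj N x"
  define t where "t = norm q"
  define s where "s = norm (x - q)"
  have x2: "(norm x)\<^sup>2 = t\<^sup>2 + s\<^sup>2"
    unfolding t_def s_def q_def using norm_proj_sq[OF N] .
  have "t \<le> c * norm x"
    unfolding t_def q_def c_def by (rule norm_proj_le_angle_cos[OF sM N xM xMN])
  then have "t\<^sup>2 \<le> c\<^sup>2 * (norm x)\<^sup>2"
    by (metis norm_ge_zero power_mono power_mult_distrib t_def)
  then have s2: "(1 - c\<^sup>2) * (norm x)\<^sup>2 \<le> s\<^sup>2" using x2 by (simp add: algebra_simps)
  have "(norm x)\<^sup>2 = norm (ip x (v + w))"
    using ip_proj_right[OF M xM, of "v + w"] norm_ip_self[of x] by (simp only: x_def[symmetric])
  also have "ip x (v + w) = ip q v + ip (x - q) w"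
  proof -
    have "ip q w = 0" using proj_decomposition(1)[OF N, of x] w
      by (auto simp: q_def orth_def ip_eq_zero_commute)
    moreover have "ip q v = ip x v" unfolding q_def using N v(1) by (rule ip_proj_left)
    ultimately show ?thesis by (simp add: ip_add_right ip_diff_left)
  qed
  also have "norm (ip q v + ip (x - q) w) \<le> norm (ip q v) + norm (ip (x - q) w)"
    by (rule norm_triangle_ineq)
  also have "\<dots> \<le> t * norm v + s * norm w"
    unfolding t_def s_def by (intro add_mono norm_ip_le)
  finally have "(norm x)\<^sup>2 \<le> t * norm v + s * norm w" .
  then have "((norm x)\<^sup>2)\<^sup>2 \<le> (t * norm v + s * norm w)\<^sup>2"
    by (intro power_mono) auto
  \<comment> \<open>Cauchy--Schwarz in the plane, after moving the factor \<open>sqrt (1 - p)\<close> from \<open>w\<close> to \<open>s\<close>.\<close>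
  also have "\<dots> \<le> (t\<^sup>2 + s\<^sup>2 * (1 - p)) * ((norm v)\<^sup>2 + W\<^sup>2)"
  proof -
    define b where "b = sqrt (1 - p)"
    have b: "0 \<le> b" "b\<^sup>2 = 1 - p" using p by (simp_all add: b_def)
    have "(norm w)\<^sup>2 \<le> (b * \<bar>W\<bar>)\<^sup>2"
      unfolding power_mult_distrib power2_abs b(2) by (rule W)
    then have "norm w \<le> b * \<bar>W\<bar>" by (rule power2_le_imp_le) (simp add: b(1))
    then have "t * norm v + s * norm w \<le> t * norm v + s * (b * \<bar>W\<bar>)"
      by (intro add_left_mono mult_left_mono) (auto simp: s_def)
    then have "(t * norm v + s * norm w)\<^sup>2 \<le> (t * norm v + (s * b) * \<bar>W\<bar>)\<^sup>2"
      by (intro power_mono) (auto simp: s_def t_def mult_ac)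
    also have "\<dots> \<le> (t\<^sup>2 + (s * b)\<^sup>2) * ((norm v)\<^sup>2 + \<bar>W\<bar>\<^sup>2)"
      using zero_le_power2[of "t * \<bar>W\<bar> - (s * b) * norm v"]
      by (simp add: power2_eq_square algebra_simps)
    finally show ?thesis by (simp add: power_mult_distrib b)
  qed
  also have "\<dots> \<le> ((norm x)\<^sup>2 * (1 - (1 - c\<^sup>2) * p)) * ((norm v)\<^sup>2 + W\<^sup>2)"
  proof (rule mult_right_mono)
    show "t\<^sup>2 + s\<^sup>2 * (1 - p) \<le> (norm x)\<^sup>2 * (1 - (1 - c\<^sup>2) * p)"
      using mult_right_mono[OF s2 p(1)] x2 by (simp add: algebra_simps)
  qed simp
  finally have *: "(norm x)\<^sup>2 * (norm x)\<^sup>2 \<le> (norm x)\<^sup>2 * ((1 - (1 - c\<^sup>2) * p) * ((norm v)\<^sup>2 + W\<^sup>2))"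
    by (simp add: power2_eq_square[of "(norm x)\<^sup>2"] mult_ac)
  have "(norm x)\<^sup>2 \<le> (1 - (1 - c\<^sup>2) * p) * ((norm v)\<^sup>2 + W\<^sup>2)"
  proof (cases "x = 0")
    case True
    have "(1 - c\<^sup>2) * p \<le> 1 * 1" using c p by (intro mult_mono) (auto simp: power_le_one)
    then show ?thesis using True by simp
  next
    case False
    then show ?thesis by (intro mult_left_le_imp_le[OF *]) simp
  qed
  then show ?thesis by (simp add: x_def c_def)
qed

text \<open>
  Downward induction on \<open>k\<close>, starting from the empty product of projectors at \<open>k = m\<close>: there \<open>N m\<close> is
  the whole space, so \<open>y = 0\<close>.
\<close>

lemma sweep_contracts:
  assumes M: "\<And>i. i \<in> {1..m} \<Longrightarrow> closed_subspace (M i)"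
    and N: "\<And>k. k \<le> m \<Longrightarrow> N k = (\<Inter>i\<in>{Suc k..m}. M i)"
    and c1: "\<And>i. i \<in> {1..m} \<Longrightarrow> angle_cos ip (M i) (N i) \<le> 1"
    and k: "k \<le> m" and y: "y \<in> orth ip (N k)"
  shows "(norm (foldr (\<lambda>i. proj (M i)) [Suc k..<Suc m] y))\<^sup>2
    \<le> (1 - (\<Prod>i\<in>{Suc k..m}. 1 - (angle_cos ip (M i) (N i))\<^sup>2)) * (norm y)\<^sup>2"
  using k y
proof (induction k arbitrary: y rule: inc_induct)
  case base
  then have "ip y y = 0" using N by (simp add: orth_def)
  then show ?case by (simp add: ip_self)
next
  case (step n)
  define T where "T = foldr (\<lambda>i. proj (M i)) [Suc (Suc n)..<Suc m]"
  define K where "K = N (Suc n)"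
  define p where "p = (\<Prod>i\<in>{Suc (Suc n)..m}. 1 - (angle_cos ip (M i) (N i))\<^sup>2)"
  have Mi: "closed_subspace (M i)" if "i \<in> {Suc n..m}" for i using M that by simp
  have Meq: "closed_subspace (M (Suc n))" using Mi step.hyps by simp
  have Keq: "K = (\<Inter>i\<in>{Suc (Suc n)..m}. M i)" using N step.hyps by (simp add: K_def)
  have K: "closed_subspace K"
    using Mi unfolding closed_subspace_def Keq
    by (auto intro!: subspace_Inter closed_INT)
  have Nn: "N n = M (Suc n) \<inter> K"
  proof -
    have "{Suc n..m} = insert (Suc n) {Suc (Suc n)..m}" using step.hyps by auto
    then show ?thesis using N[of n] step.hyps by (simp add: Keq)
  qed
  have c: "0 \<le> angle_cos ip (M i) (N i)" "angle_cos ip (M i) (N i) \<le> 1"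
    if "i \<in> {Suc n..m}" for i
  proof -
    have "0 \<in> M i" using Mi[OF that] by (simp add: closed_subspace_def subspace_0)
    moreover have "0 \<in> N i"
      using N[of i] Mi that by (auto simp: closed_subspace_def intro!: subspace_0)
    ultimately show "0 \<le> angle_cos ip (M i) (N i)" by (rule angle_cos_nonneg)
    show "angle_cos ip (M i) (N i) \<le> 1" using c1 that by simp
  qed
  have p: "0 \<le> p" "p \<le> 1"
    unfolding p_def using c by (auto intro!: prod_nonneg prod_le_1 simp: power_le_one)
  define v where "v = proj K y"
  define w where "w = y - v"
  have v: "v \<in> K" and w: "w \<in> orth ip K"
    unfolding v_def w_def using proj_decomposition[OF K] by auto
  have vN: "v \<in> orth ip (M (Suc n) \<inter> K)"
  proof -
    have "w \<in> orth ip (M (Suc n) \<inter> K)" using w orth_antimono by blast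
    then have "y - w \<in> orth ip (M (Suc n) \<inter> K)"
      using step.prems unfolding Nn using subspace_orth subspace_diff by blast
    then show ?thesis by (simp add: w_def)
  qed
  have T: "T y = v + T w"
  proof -
    have "T (v + w) = T v + T w"
      unfolding T_def using Mi by (intro foldr_proj_add) auto
    moreover have "T v = v"
      unfolding T_def using Mi v by (intro foldr_proj_fixed) (auto simp: Keq)
    moreover have "v + w = y" by (simp add: w_def)
    ultimately show ?thesis by argo
  qed
  have Tw: "T w \<in> orth ip K"
    unfolding T_def using Mi w by (intro foldr_proj_mem_orth) (auto simp: Keq)
  have IH: "(norm (T w))\<^sup>2 \<le> (1 - p) * (norm w)\<^sup>2"
    unfolding T_def p_def using step.IH w by (simp add: K_def)
  have upt: "[Suc n..<Suc m] = Suc n # [Suc (Suc n)..<Suc m]"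
    using step.hyps by (intro upt_conv_Cons) simp
  have "foldr (\<lambda>i. proj (M i)) [Suc n..<Suc m] y = proj (M (Suc n)) (T y)"
    by (subst upt) (simp add: T_def del: upt_Suc)
  then have sweep: "foldr (\<lambda>i. proj (M i)) [Suc n..<Suc m] y = proj (M (Suc n)) (v + T w)"
    using T by argo
  have bound: "(norm (proj (M (Suc n)) (v + T w)))\<^sup>2
      \<le> (1 - (1 - (angle_cos ip (M (Suc n)) K)\<^sup>2) * p) * ((norm v)\<^sup>2 + (norm w)\<^sup>2)"
  proof (rule norm_proj_sum_sq_le[OF Meq K v vN Tw p IH])
    show "angle_cos ip (M (Suc n)) K \<le> 1" using c(2)[of "Suc n"] step.hyps by (simp add: K_def)
  qed
  have pyth: "(norm v)\<^sup>2 + (norm w)\<^sup>2 = (norm y)\<^sup>2"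
    using norm_proj_sq[OF K, of y] by (simp add: v_def w_def)
  have factor: "(\<Prod>i\<in>{Suc n..m}. 1 - (angle_cos ip (M i) (N i))\<^sup>2)
      = (1 - (angle_cos ip (M (Suc n)) K)\<^sup>2) * p"
  proof -
    have "{Suc n..m} = insert (Suc n) {Suc (Suc n)..m}" using step.hyps by auto
    then show ?thesis by (simp add: p_def K_def)
  qed
  show ?case unfolding sweep factor pyth[symmetric] by (rule bound)
qed


section \<open>Affine projectors and the inverse best approximation property\<close>

lemma proj_translate:
  assumes M: "closed_subspace M"
  shows "proj (a +o M) x = a + proj M (x - a)"
proof -
  note d = proj_decomposition[OF M, of "x - a"]
  have pyth: "(norm (x - (a + y)))\<^sup>2 =
      (norm (x - (a + proj M (x - a))))\<^sup>2 + (norm (proj M (x - a) - y))\<^sup>2" if "y \<in> M" for y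
  proof -
    have "proj M (x - a) - y \<in> M"
      using M d that by (simp add: closed_subspace_def subspace_diff)
    then have "ip (x - a - proj M (x - a)) (proj M (x - a) - y) = 0"
      using d by (auto simp: orth_def)
    from norm_add_sq[OF this] show ?thesis by (simp add: algebra_simps)
  qed
  have near: "dist x (a + proj M (x - a)) \<le> dist x y" if "y \<in> a +o M" for y
  proof -
    obtain z where z: "z \<in> M" "y = a + z" using \<open>y \<in> a +o M\<close> by (auto simp: elt_set_plus_def)
    have "(norm (x - (a + proj M (x - a))))\<^sup>2 \<le> (norm (x - y))\<^sup>2"
      unfolding z(2) pyth[OF z(1)] by simp
    then show ?thesis unfolding dist_norm by (rule power2_le_imp_le) simp
  qed
  show ?thesis
    unfolding proj_def[of "a +o M"]
  proof (rule the_equality)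
    show "a + proj M (x - a) \<in> a +o M \<and> (\<forall>y\<in>a +o M. dist x (a + proj M (x - a)) \<le> dist x y)"
      using d(1) near by blast
  next
    fix q assume q: "q \<in> a +o M \<and> (\<forall>y\<in>a +o M. dist x q \<le> dist x y)"
    then obtain z where z: "z \<in> M" "q = a + z" by (auto simp: elt_set_plus_def)
    have "a + proj M (x - a) \<in> a +o M" using d by blast
    then have "norm (x - q) \<le> norm (x - (a + proj M (x - a)))"
      using q unfolding dist_norm by blast
    then have "(norm (x - q))\<^sup>2 \<le> (norm (x - (a + proj M (x - a))))\<^sup>2"
      by (simp add: power_mono)
    then show "q = a + proj M (x - a)" using pyth[OF z(1)] z(2) by simp
  qed
qed

lemma affine_proj_eq:
  assumes "closed_subspace (U i)" and "proj (U i) b = u i"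
  shows "affine_proj ip U u i (b + y) = b + proj (orth ip (U i)) y"
proof -
  note cs = closed_subspace_orth[of "U i"]
  have "b - u i \<in> orth ip (U i)"
    using proj_decomposition(2)[OF assms(1), of b] assms(2) by simp
  have "affine_proj ip U u i (b + y) = u i + proj (orth ip (U i)) ((b - u i) + y)"
    unfolding affine_proj_def proj_translate[OF cs] by (simp only: diff_add_eq)
  also have "\<dots> = b + proj (orth ip (U i)) y"
    unfolding proj_add[OF cs] proj_self[OF cs \<open>b - u i \<in> orth ip (U i)\<close>] by simp
  finally show ?thesis .
qed

lemma foldr_affine_proj_eq:
  assumes "\<And>i. i \<in> set is \<Longrightarrow> closed_subspace (U i)" and "\<And>i. i \<in> set is \<Longrightarrow> proj (U i) b = u i"
  shows "foldr (affine_proj ip U u) is (b + y) =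
    b + foldr (\<lambda>i. proj (orth ip (U i))) is y"
  using assms
proof (induction "is")
  case (Cons i "is")
  then have "foldr (affine_proj ip U u) is (b + y) = b + foldr (\<lambda>i. proj (orth ip (U i))) is y"
    by simp
  then show ?case using Cons.prems affine_proj_eq[of U i b u] by simp
qed simp

lemma orth_sum:
  assumes "finite J" and "\<And>j. j \<in> J \<Longrightarrow> 0 \<in> U j"
  shows "orth ip (\<Sum>j\<in>J. U j) = (\<Inter>j\<in>J. orth ip (U j))"
  using assms
proof (induction rule: finite_induct)
  case empty
  then show ?case by (auto simp: orth_def)
next
  case (insert j J)
  have "0 \<in> (\<Sum>j\<in>J. U j)"
    using insert by (auto simp: set_sum_alt intro!: exI[of _ "\<lambda>_. 0"])
  moreover have "orth ip (S + S') = orth ip S \<inter> orth ip S'" if "0 \<in> S" "0 \<in> S'" for S S' :: "'a set"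
  proof
    have "S \<subseteq> S + S'" "S' \<subseteq> S + S'"
      using set_zero_plus2[of S S'] set_zero_plus2[of S' S] that by (auto simp: add.commute)
    then show "orth ip (S + S') \<subseteq> orth ip S \<inter> orth ip S'" using orth_antimono by blast
    show "orth ip S \<inter> orth ip S' \<subseteq> orth ip (S + S')"
      by (auto simp: orth_def ip_add_right elim!: set_plus_elim)
  qed
  ultimately show ?case using insert by simp
qed

lemma solutions_eq_translate:
  assumes U: "\<And>i. i \<in> {1..m} \<Longrightarrow> closed_subspace (U i)"
    and b: "\<And>i. i \<in> {1..m} \<Longrightarrow> proj (U i) b = u i"
  shows "solutions m U u = b +o (\<Inter>i\<in>{1..m}. orth ip (U i))"
proof -
  have "proj (U i) x = u i \<longleftrightarrow> x - b \<in> orth ip (U i)" if i: "i \<in> {1..m}" for i x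
  proof -
    have "proj (U i) x = proj (U i) (x - b) + u i"
      using proj_add[OF U[OF i], of "x - b" b] b[OF i] by simp
    then have "proj (U i) x = u i \<longleftrightarrow> proj (U i) (x - b) = 0" by simp
    also have "\<dots> \<longleftrightarrow> x - b \<in> orth ip (U i)"
      using proj_decomposition(2)[OF U[OF i], of "x - b"] proj_eqI[OF U[OF i], of 0 "x - b"] U[OF i]
      by (auto simp: closed_subspace_def subspace_0)
    finally show ?thesis .
  qed
  then show ?thesis by (auto simp: solutions_def set_minus_plus[symmetric])
qed

text \<open>
  Prescribing the projections of \<open>x\<close> to be \<open>0\<close> on \<open>U i\<close> and those of \<open>h\<close> on the later subspaces splits
  an arbitrary \<open>h\<close> as \<open>x + (h - x)\<close> along the two complements.
\<close>

lemma ibap_angle_cos_less_1: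
  assumes ibap: "ibap m U" and U: "\<And>i. i \<in> {1..m} \<Longrightarrow> closed_subspace (U i)" and i: "i \<in> {1..m}"
  shows "angle_cos ip (orth ip (U i)) (orth ip (tail_sum m U i)) < 1"
proof (rule angle_cos_less_1[OF closed_subspace_orth closed_subspace_orth])
  fix h
  have U0: "0 \<in> U j" if "j \<in> {1..m}" for j using U that by (simp add: closed_subspace_def subspace_0)
  define u where "u j = (if i < j then proj (U j) h else 0)" for j
  have "\<forall>j\<in>{1..m}. u j \<in> U j" using proj_decomposition(1) U U0 by (simp add: u_def)
  then obtain x where x: "\<And>j. j \<in> {1..m} \<Longrightarrow> proj (U j) x = u j"
    using ibap unfolding ibap_def by blast
  have xi: "x \<in> orth ip (U i)" using proj_decomposition(2)[OF U[OF i], of x] x[OF i] by (simp add: u_def)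
  have "h - x \<in> orth ip (U j)" if j: "j \<in> {i+1..m}" for j
  proof -
    have Uj: "closed_subspace (U j)" using U j by simp
    have "proj (U j) x = proj (U j) h" using x[of j] j by (simp add: u_def)
    then have "h - x = (h - proj (U j) h) - (x - proj (U j) x)" by simp
    then show ?thesis
      using proj_decomposition(2)[OF Uj] subspace_orth subspace_diff by metis
  qed
  then have "h - x \<in> orth ip (tail_sum m U i)"
    using U0 i orth_sum[of "{i+1..m}" U] by (simp add: tail_sum_def)
  then show "\<exists>a\<in>orth ip (U i). \<exists>b\<in>orth ip (tail_sum m U i). h = a + b"
    using xi by (intro bexI[of _ x] bexI[of _ "h - x"]) simp_all
qed

end


section \<open>Linear convergence of the periodic projection algorithm\<close>

theorem proposition3p2:
  fixes scale :: "'k::real_or_complex \<Rightarrow> 'a::banach \<Rightarrow> 'a"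
    and ip :: "'a \<Rightarrow> 'a \<Rightarrow> 'k"
    and m :: nat
    and U :: "nat \<Rightarrow> 'a set"
    and \<alpha> :: real
  assumes "hilbert_space scale ip"
    and "m \<ge> 1"
    and "\<And>i. i \<in> {1..m} \<Longrightarrow> module.subspace scale (U i) \<and> closed (U i)"
    and "ibap m U"
    and "\<alpha> = sqrt (1 - (\<Prod>i\<in>{1..m-1}.
                 1 - (angle_cos ip (orth ip (U i)) (orth ip (tail_sum m U i)))\<^sup>2))"
  shows "\<alpha> \<in> {0..<1} \<and>
    (\<forall>r u x. (\<forall>i\<in>{1..m}. u i \<in> U i) \<longrightarrow>
       x 0 = r \<longrightarrow>
       (\<forall>n. x (Suc n) = foldr (affine_proj ip U u) [1..<Suc m] (x n)) \<longrightarrow>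
       (\<forall>n. norm (x n - proj (solutions m U u) r)
              \<le> \<alpha> ^ n * norm (r - proj (solutions m U u) r)))"
proof -
  interpret hilbert_space scale ip by fact
  define M where "M i = orth ip (U i)" for i
  define N where "N i = orth ip (tail_sum m U i)" for i
  define c where "c i = angle_cos ip (M i) (N i)" for i
  define p where "p = (\<Prod>i\<in>{1..m}. 1 - (c i)\<^sup>2)"
  have U: "closed_subspace (U i)" if "i \<in> {1..m}" for i
    using assms(3)[OF that] by (simp add: closed_subspace_def)
  have M: "closed_subspace (M i)" for i by (simp add: M_def closed_subspace_orth)
  have N: "N k = (\<Inter>i\<in>{Suc k..m}. M i)" for k
  proof -
    have "0 \<in> U j" if "j \<in> {k+1..m}" for j using U that by (simp add: closed_subspace_def subspace_0)
    then show ?thesis using orth_sum[of "{k+1..m}" U] by (simp add: N_def M_def tail_sum_def)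
  qed
  have NI: "closed_subspace (N k)" for k by (simp add: N_def closed_subspace_orth)
  have zero: "0 \<in> M i" "0 \<in> N i" for i
    using M NI by (simp_all add: closed_subspace_def subspace_0)
  have c: "0 \<le> c i" "c i < 1" if "i \<in> {1..m}" for i
    using angle_cos_nonneg[OF zero] ibap_angle_cos_less_1[OF assms(4) U that]
    by (simp_all add: c_def M_def N_def)
  \<comment> \<open>The factor for \<open>i = m\<close> is \<open>1\<close>, since the last tail sum is \<open>{0}\<close>.\<close>
  have "c m = 0" using angle_cos_UNIV[OF zero(1)] N[of m] by (simp add: c_def)
  moreover have "{1..m} = insert m {1..m-1}" using assms(2) by auto
  ultimately have "p = (\<Prod>i\<in>{1..m-1}. 1 - (c i)\<^sup>2)"
    using assms(2) by (simp add: p_def)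
  then have alpha: "\<alpha> = sqrt (1 - p)" using assms(5) by (simp add: c_def M_def N_def)
  have p: "0 < p" "p \<le> 1"
    unfolding p_def using c
    by (auto intro!: prod_pos prod_le_1 simp: power_le_one abs_square_less_1 abs_square_le_1 less_imp_le)
  have alpha01: "0 \<le> \<alpha>" "\<alpha> < 1" and alpha2: "\<alpha>\<^sup>2 = 1 - p" using p by (simp_all add: alpha)
  have rate: "norm (x n - proj (solutions m U u) r) \<le> \<alpha> ^ n * norm (r - proj (solutions m U u) r)"
    if u: "\<forall>i\<in>{1..m}. u i \<in> U i" and x0: "x 0 = r"
      and xS: "\<forall>n. x (Suc n) = foldr (affine_proj ip U u) [1..<Suc m] (x n)" for r u x n
  proof -
    obtain b0 where b0: "\<And>i. i \<in> {1..m} \<Longrightarrow> proj (U i) b0 = u i"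
      using assms(4) u unfolding ibap_def by blast
    have sol: "solutions m U u = b0 +o N 0"
      using solutions_eq_translate[OF U b0] by (simp add: N M_def)
    define b where "b = proj (solutions m U u) r"
    have b_eq: "b = b0 + proj (N 0) (r - b0)"
      by (simp add: b_def sol proj_translate[OF NI])
    then have "b \<in> solutions m U u" using proj_decomposition(1)[OF NI] by (auto simp: sol)
    then have b: "proj (U i) b = u i" if "i \<in> {1..m}" for i
      using that by (simp add: solutions_def)
    define T where "T = foldr (\<lambda>i. proj (M i)) [1..<Suc m]"
    have step: "x (Suc n) - b = T (x n - b)" for n
    proof -
      have "x (Suc n) = foldr (affine_proj ip U u) [1..<Suc m] (b + (x n - b))" using xS by simp
      also have "\<dots> = b + T (x n - b)"
        unfolding T_def M_def by (rule foldr_affine_proj_eq) (auto simp: U b)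
      finally show ?thesis by simp
    qed
    have T: "norm (T y) \<le> \<alpha> * norm y" "T y \<in> orth ip (N 0)" if y: "y \<in> orth ip (N 0)" for y
    proof -
      have "(norm (T y))\<^sup>2 \<le> (1 - p) * (norm y)\<^sup>2"
        using sweep_contracts[of m M N 0 y] M N c(2) y by (force simp: T_def p_def c_def)
      then have "(norm (T y))\<^sup>2 \<le> (\<alpha> * norm y)\<^sup>2" by (simp add: power_mult_distrib alpha2)
      then show "norm (T y) \<le> \<alpha> * norm y" by (rule power2_le_imp_le) (simp add: alpha01(1))
      show "T y \<in> orth ip (N 0)"
        unfolding T_def using M y by (intro foldr_proj_mem_orth) (auto simp: N)
    qed
    have "x n - b \<in> orth ip (N 0) \<and> norm (x n - b) \<le> \<alpha> ^ n * norm (r - b)"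
    proof (induction n)
      case 0
      have "r - b = (r - b0) - proj (N 0) (r - b0)" by (simp add: b_eq)
      then have "r - b \<in> orth ip (N 0)" using proj_decomposition(2)[OF NI, of "r - b0" 0] by (simp only:)
      then show ?case using x0 by simp
    next
      case (Suc n)
      then have "norm (x (Suc n) - b) \<le> \<alpha> * (\<alpha> ^ n * norm (r - b))"
        using T(1) alpha01 unfolding step by (meson mult_left_mono order_trans)
      then show ?case using Suc T(2) by (simp add: step mult_ac)
    qed
    then show ?thesis by (simp add: b_def)
  qed
  show ?thesis using alpha01 rate by auto
qed

end
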